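(* Let $A\in\mathbb{C}^{n\times n}$, $B\in\mathbb{C}^{m\times n}$, $C\in\mathbb{C}^{n\times m}$, $D\in\mathbb{C}^{m\times m}$, and let $S,s,Z,z,E,M_E$ be the matrices built from them as in the context. The following statements are equivalent: (1) $M_E^\#$ exists, and $M_E^e=E$; (2) $s^\#$ exists, and $s^e=A^e$; (3) $z^\#$ exists, and $z^e=D^e$; (4) $A^\pi+s$ is invertible; (5) $I+A^d(s-A)$ is invertible (or, as an equivalent alternative, $I+A^d(S-I)A$ is invertible); (6) $s^d=(I+A^d(s-A))^{-1}A^d$; (7) $D^\pi+z$ is invertible; (8) $I+D^d(z-D)$ is invertible (or, as an equivalent alternative, $I+D^d(Z-I)D$ is invertible); (9) $z^d=(I+D^d(z-D))^{-1}D^d$; (10) $s^\#$ and $z^\#$ exist, $s^\#=A^dCz^\#BA^d+A^d$, and $A^dCz^\#=s^\#CD^d$; (11) $s^\#$ and $z^\#$ exist, $z^\#=D^dBs^\#CD^d+D^d$, and $D^dBs^\#=z^\#BA^d$; (12) $M_E^\#$ exists, and $$M_E^\#=\begin{bmatrix} A^d+A^dCz^\#BA^d & -A^dCz^\# \\ -z^\#BA^d & z^\#\end{bmatrix}=\begin{bmatrix} s^\# & -s^\#CD^d\\ -D^dBs^\# & D^dBs^\#CD^d+D^d\end{bmatrix}.$$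
   Context: All matrices are complex; $I$ is an identity matrix of the proper size. For a square matrix $X$: the Drazin inverse $X^d$ is the unique matrix with $XX^d=X^dX$, $X^dXX^d=X^d$, $X^k=X^{k+1}X^d$, where $k=\mathrm{ind}(X)$ is the smallest non-negative integer with $\mathrm{rank}(X^k)=\mathrm{rank}(X^{k+1})$ (it always exists). The group inverse $X^\#$, when it exists, is the unique matrix with $XX^\#X=X$, $X^\#XX^\#=X^\#$, $XX^\#=X^\#X$. Put $X^e=XX^d$ and $X^\pi=I-X^e$. An equation containing a group inverse or an ordinary inverse includes the assertion that it exists. Notation: $S=A-CD^dB$, $s=A^eSA^e$, $Z=D-BA^dC$, $z=D^eZD^e$, $M=\begin{bmatrix}A&C\\ B&D\end{bmatrix}$, $E=\begin{bmatrix}A^e&0\\ 0&D^e\end{bmatrix}$, $M_E=EME=\begin{bmatrix}AA^e&A^eCD^e\\ D^eBA^e&DD^e\end{bmatrix}$, and $M_E^e=M_EM_E^d$. *)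

theory Defs
  imports "HOL-Analysis.Analysis"
begin

(* On square matrices of type 'a^'n^'n the library's "^" is the componentwise power,
   so powers with respect to "**" are defined here. *)
primrec matrix_power :: "complex^'n^'n \<Rightarrow> nat \<Rightarrow> complex^'n^'n" where
  "matrix_power X 0 = mat 1"
| "matrix_power X (Suc k) = X ** matrix_power X k"

definition matrix_index :: "complex^'n^'n \<Rightarrow> nat" where
  "matrix_index X = (LEAST k. rank (matrix_power X k) = rank (matrix_power X (k + 1)))"

definition is_drazin_inverse :: "complex^'n^'n \<Rightarrow> complex^'n^'n \<Rightarrow> bool" where
  "is_drazin_inverse X Y \<longleftrightarrow>
     X ** Y = Y ** X \<and>
     Y ** X ** Y = Y \<and>
     matrix_power X (matrix_index X) = matrix_power X (matrix_index X + 1) ** Y"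

(* Every square matrix over the complex numbers has exactly one Drazin inverse. *)
definition drazin :: "complex^'n^'n \<Rightarrow> complex^'n^'n" where
  "drazin X = (THE Y. is_drazin_inverse X Y)"

definition is_group_inverse :: "complex^'n^'n \<Rightarrow> complex^'n^'n \<Rightarrow> bool" where
  "is_group_inverse X Y \<longleftrightarrow> X ** Y ** X = X \<and> Y ** X ** Y = Y \<and> X ** Y = Y ** X"

definition has_group_inverse :: "complex^'n^'n \<Rightarrow> bool" where
  "has_group_inverse X \<longleftrightarrow> (\<exists>Y. is_group_inverse X Y)"

(* A group inverse is unique if it exists; the value is meaningful only under
   has_group_inverse X. *)
definition group_inverse :: "complex^'n^'n \<Rightarrow> complex^'n^'n" where
  "group_inverse X = (THE Y. is_group_inverse X Y)"

(* X^e *)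
definition core_proj :: "complex^'n^'n \<Rightarrow> complex^'n^'n" where
  "core_proj X = X ** drazin X"

(* X^\<pi> *)
definition spectral_proj :: "complex^'n^'n \<Rightarrow> complex^'n^'n" where
  "spectral_proj X = mat 1 - core_proj X"

(* block_matrix P Q R T has first block row (P, Q) and second block row (R, T);
   rows and columns are indexed by the disjoint sum of the two index types. *)
definition block_matrix ::
  "complex^'n^'n \<Rightarrow> complex^'m^'n \<Rightarrow> complex^'n^'m \<Rightarrow> complex^'m^'m
     \<Rightarrow> complex^('n + 'm)^('n + 'm)" where
  "block_matrix P Q R T =
     (\<chi> i j. case i of
        Inl a \<Rightarrow> (case j of Inl b \<Rightarrow> P $ a $ b | Inr b \<Rightarrow> Q $ a $ b)
      | Inr a \<Rightarrow> (case j of Inl b \<Rightarrow> R $ a $ b | Inr b \<Rightarrow> T $ a $ b))"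

definition all_equivalent :: "bool list \<Rightarrow> bool" where
  "all_equivalent ps \<longleftrightarrow> (\<forall>p\<in>set ps. \<forall>q\<in>set ps. p \<longleftrightarrow> q)"

end

theory Submission
  imports Defs
begin

text \<open>
  Replacing \<open>A, B, C, D\<close> by their corners with respect to the idempotents
  \<open>P = A\<^sup>e\<close> and \<open>Q = D\<^sup>e\<close> turns the Drazin inverses \<open>A\<^sup>d, D\<^sup>d\<close> into honest two-sided
  inverses in the corner rings of \<open>P\<close> and \<open>Q\<close>, and \<open>s, z\<close> into honest Schur complements of \<open>M_E\<close>.
  By the block inversion formula \<open>s\<close> is invertible in the corner of \<open>P\<close> iff \<open>M_E\<close> is invertible
  in the corner of \<open>E\<close>, iff \<open>z\<close> is invertible in the corner of \<open>Q\<close>; every listed statement is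
  a reformulation of this.  For (10), the projection \<open>P - s s\<^sup>#\<close> kills \<open>s\<^sup>#\<close>, so by the two formulas
  it also kills \<open>A\<^sup>d\<close>, and hence it is zero.
\<close>

section \<open>The Drazin inverse\<close>

lemma span_columns: "vec.span (columns A) = range ((*v) A)"
  for A :: "'a::field^'n^'m"
proof
  have "column j A = A *v axis j 1" for j
    by (simp add: vec_eq_iff matrix_vector_mult_def column_def axis_def if_distrib cong: if_cong)
  moreover have "vec.subspace (range ((*v) A))"
    using vec.subspace_image[OF vec.subspace_UNIV] .
  ultimately show "vec.span (columns A) \<subseteq> range ((*v) A)"
    by (intro vec.span_minimal) (auto simp: columns_def)
qed (use matrix_vector_mult_in_columnspace_gen in blast)

lemma rank_eq_dim_range_transpose: "rank A = vec.dim (range ((*v) (transpose A)))"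
  for A :: "'a::field^'n^'m"
  by (metis columns_transpose row_rank_def_gen span_columns vec.dim_span)

lemma range_matrix_mul_subset: "range ((*v) (A ** B)) \<subseteq> range ((*v) A)"
  by (auto simp flip: matrix_vector_mul_assoc)

text \<open>Each column of \<open>A\<close> has a preimage under \<open>B\<close>; these preimages
  are the columns of \<open>W\<close>.\<close>

lemma right_factor_exists:
  fixes A :: "'a::field^'n^'m" and B :: "'a^'k^'m"
  assumes "range ((*v) A) \<subseteq> range ((*v) B)"
  obtains W where "A = B ** W"
proof -
  have "\<exists>w. A *v axis j 1 = B *v w" for j
    using assms by blast
  then obtain w where w: "A *v axis j 1 = B *v w j" for j
    by metis
  have col: "A $ i $ j = (B *v w j) $ i" for i j
    by (simp flip: w)
       (simp add: matrix_vector_mult_def axis_def if_distrib cong: if_cong)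
  have "A = B ** (\<chi> i j. w j $ i)"
    by (simp add: vec_eq_iff col matrix_matrix_mult_def) (simp add: matrix_vector_mult_def)
  then show thesis
    by (rule that)
qed

lemma rank_matrix_mul_le: "rank (A ** B) \<le> rank B"
  for A :: "'a::field^'n^'m" and B :: "'a^'k^'n"
  unfolding rank_eq_dim_range_transpose matrix_transpose_mul
  by (intro vec.dim_subset range_matrix_mul_subset)

text \<open>The row space of \<open>A ** B\<close> lies in that of \<open>B\<close>, and equal
  dimension makes the two coincide. After transposition this is the range inclusion needed for a
  right factor.\<close>

lemma left_factor_exists:
  fixes A :: "'a::field^'n^'m" and B :: "'a^'k^'n"
  assumes "rank (A ** B) = rank B"
  obtains V where "B = V ** (A ** B)"
proof -
  have "range ((*v) (transpose (A ** B))) = range ((*v) (transpose B))"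
    using assms unfolding rank_eq_dim_range_transpose matrix_transpose_mul
    by (intro vec.subspace_dim_equal vec.subspace_image[OF vec.subspace_UNIV]
        range_matrix_mul_subset) simp
  then obtain V where "transpose B = transpose (A ** B) ** V"
    by (metis right_factor_exists subset_refl)
  then have "B = transpose V ** (A ** B)"
    by (metis matrix_transpose_mul transpose_transpose)
  then show thesis
    by (rule that)
qed

section \<open>Powers of a matrix and their stabilization at the index\<close>

lemma matrix_power_commute: "matrix_power X k ** X = X ** matrix_power X k"
  by (induction k) (simp_all flip: matrix_mul_assoc)

lemma matrix_power_add: "matrix_power X (j + k) = matrix_power X j ** matrix_power X k"
  by (induction j) (simp_all add: matrix_mul_assoc)

text \<open>The \<open>LEAST\<close> in the index is attained: otherwise the ranks of the powers
  would decrease strictly forever.\<close>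

lemma rank_matrix_power_index:
  "rank (matrix_power X (matrix_index X)) = rank (matrix_power X (Suc (matrix_index X)))"
proof -
  let ?r = "\<lambda>k. rank (matrix_power X k)"
  have "\<exists>k. ?r k = ?r (k + 1)"
  proof (rule ccontr)
    assume "\<nexists>k. ?r k = ?r (k + 1)"
    then have "?r (Suc k) < ?r k" for k
      using rank_matrix_mul_le[of X "matrix_power X k"] by (simp add: order_less_le) metis
    then have "\<exists>f. \<forall>k. (f (Suc k), f k) \<in> less_than"
      by (intro exI[of _ ?r]) simp
    then show False
      using wf_less_than wf_iff_no_infinite_down_chain by blast
  qed
  then show ?thesis
    unfolding matrix_index_def by (metis (mono_tags, lifting) LeastI_ex Suc_eq_plus1)
qed

lemma matrix_power_index_left:
  obtains V where "matrix_power X (matrix_index X) = V ** (X ** matrix_power X (matrix_index X))"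
  using left_factor_exists[of X "matrix_power X (matrix_index X)"] rank_matrix_power_index[of X]
  by auto

text \<open>The left factor makes \<open>X\<close> injective on the range of \<open>?Q\<close>.
  Hence \<open>X\<close> preserves the dimension of that range while mapping it into itself, so it
  maps it onto itself.\<close>

lemma matrix_power_index_right:
  obtains W where "matrix_power X (matrix_index X) = X ** matrix_power X (matrix_index X) ** W"
proof -
  let ?Q = "matrix_power X (matrix_index X)"
  obtain V where V: "?Q = V ** (X ** ?Q)"
    by (rule matrix_power_index_left)
  have "x = y" if "X *v x = X *v y" "x \<in> range ((*v) ?Q)" "y \<in> range ((*v) ?Q)" for x y
    using that V by (auto simp: image_iff) (metis matrix_vector_mul_assoc)
  then have "inj_on ((*v) X) (vec.span (range ((*v) ?Q)))"
    by (simp add: inj_on_def vec.span_eq_iff[THEN iffD2, OF vec.subspace_image[OF vec.subspace_UNIV]])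
  then have "vec.dim ((*v) X ` range ((*v) ?Q)) = vec.dim (range ((*v) ?Q))"
    by (intro vec.dim_image_eq) auto
  moreover have img: "(*v) X ` range ((*v) ?Q) = range ((*v) (X ** ?Q))"
    by (simp add: image_image matrix_vector_mul_assoc)
  moreover have "range ((*v) (X ** ?Q)) \<subseteq> range ((*v) ?Q)"
    by (metis matrix_power_commute range_matrix_mul_subset)
  ultimately have "range ((*v) (X ** ?Q)) = range ((*v) ?Q)"
    by (intro vec.subspace_dim_equal vec.subspace_image[OF vec.subspace_UNIV]) simp_all
  then show thesis
    by (metis right_factor_exists subset_refl that)
qed

text \<open>The factors \<open>V\<close> and \<open>W\<close> act as one-sided inverses of
  \<open>X\<close> on the stabilized power. Iterating them gives two expressions for one candidate,
  and commutation with \<open>X\<close> follows by passing from one to the other.\<close>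

lemma is_drazin_inverse_exists: "\<exists>Y. is_drazin_inverse X Y"
proof -
  define k where "k = matrix_index X"
  let ?p = "matrix_power X"
  obtain V where V: "?p k = V ** (X ** ?p k)"
    unfolding k_def by (rule matrix_power_index_left)
  obtain W where W: "?p k = X ** ?p k ** W"
    unfolding k_def by (rule matrix_power_index_right)
  have Vj: "?p k = matrix_power V j ** ?p (j + k)" for j
  proof (induction j)
    case (Suc j)
    have "?p (j + k) = V ** ?p (Suc (j + k))"
      using V by (metis matrix_power_add matrix_mul_assoc matrix_power.simps(2) add.commute matrix_power_commute)
    moreover have "matrix_power V j ** V = V ** matrix_power V j"
      by (rule matrix_power_commute)
    ultimately show ?case
      using Suc by (metis add_Suc matrix_mul_assoc matrix_power.simps(2))
  qed simp
  have Wj: "?p k = ?p (k + j) ** matrix_power W j" for j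
  proof (induction j)
    case (Suc j)
    have "?p (k + j) = ?p (k + Suc j) ** W"
      using W by (metis matrix_power_add matrix_mul_assoc matrix_power.simps(2) add.commute add_Suc_right)
    then show ?case
      using Suc by (metis matrix_mul_assoc matrix_power.simps(2))
  qed simp
  let ?v = "matrix_power V (Suc k)" and ?w = "matrix_power W (Suc k)"
  \<comment> \<open>The exponent is \<open>k + 1\<close> because \<open>k\<close> factors
    \<open>W\<close> undo \<open>?p k\<close>, and one more makes \<open>Y\<close> behave as an
    inverse of \<open>X\<close>.\<close>
  define Y where "Y = ?p k ** ?w"
  have Y': "Y = ?v ** ?p k"
  proof -
    have "Y = ?v ** ?p (Suc k + k) ** ?w"
      using Vj[of "Suc k"] by (simp add: Y_def)
    also have "\<dots> = ?v ** (?p (k + Suc k) ** ?w)"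
      by (simp add: matrix_mul_assoc add.commute)
    finally show ?thesis
      using Wj[of "Suc k"] by simp
  qed
  have comm: "X ** Y = Y ** X"
  proof -
    have "X ** Y = ?p (Suc k) ** ?w"
      by (simp add: Y_def matrix_mul_assoc)
    also have "?p (Suc k) = ?v ** ?p (Suc k + Suc k)"
    proof -
      have "?p k ** X = ?v ** ?p (Suc k + k) ** X"
        using Vj[of "Suc k"] by simp
      moreover have "?p j ** X = ?p (Suc j)" for j
        by (simp add: matrix_power_commute)
      ultimately show ?thesis
        by (metis add_Suc_right matrix_mul_assoc)
    qed
    also have "?p (Suc k + Suc k) = X ** ?p (k + Suc k)"
      by simp
    also have "?v ** (X ** ?p (k + Suc k)) ** ?w = ?v ** X ** (?p (k + Suc k) ** ?w)"
      by (simp add: matrix_mul_assoc)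
    also have "\<dots> = ?v ** X ** ?p k"
      using Wj[of "Suc k"] by simp
    also have "\<dots> = Y ** X"
      unfolding Y' by (simp only: matrix_power_commute flip: matrix_mul_assoc)
    finally show ?thesis .
  qed
  have pow: "?p (k + 1) ** Y = ?p k"
    using Wj[of "Suc k"] unfolding Y_def
    by (metis Suc_eq_plus1 add.commute matrix_mul_assoc matrix_power_add)
  have "Y ** X ** Y = ?v ** (?p (k + 1) ** Y)"
    unfolding Y' by (simp add: matrix_power_commute flip: matrix_mul_assoc)
  then have "Y ** X ** Y = Y"
    using pow Y' by simp
  with comm pow show ?thesis
    unfolding is_drazin_inverse_def k_def by metis
qed

text \<open>A Drazin inverse \<open>T\<close> can be written with the factor \<open>?p ?k\<close> at
  its left or at its right end. This power absorbs \<open>Z ** X\<close> on its left and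
  \<open>X ** Y\<close> on its right, so both inverses equal \<open>Z ** X ** Y\<close>.\<close>

lemma is_drazin_inverse_unique:
  assumes "is_drazin_inverse X Y" "is_drazin_inverse X Z"
  shows "Y = Z"
proof -
  let ?p = "matrix_power X" and ?k = "matrix_index X"
  have right: "T = ?p j ** matrix_power T (Suc j)" if "is_drazin_inverse X T" for T j
  proof (induction j)
    case (Suc j)
    have "T = X ** T ** T"
      using that by (simp add: is_drazin_inverse_def)
    then have "matrix_power T (Suc j) = X ** matrix_power T (Suc (Suc j))"
      by (metis matrix_mul_assoc matrix_power.simps(2))
    then show ?case
      using Suc by (metis matrix_mul_assoc matrix_power.simps(2) matrix_power_commute)
  qed simp
  have left: "T = matrix_power T (Suc j) ** ?p j" if "is_drazin_inverse X T" for T j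
  proof (induction j)
    case (Suc j)
    have "T = T ** T ** X"
      using that by (metis is_drazin_inverse_def matrix_mul_assoc)
    then have "matrix_power T (Suc j) = matrix_power T (Suc (Suc j)) ** X"
      by (metis matrix_mul_assoc matrix_power.simps(2) matrix_power_commute)
    then show ?case
      using Suc by (metis matrix_mul_assoc matrix_power.simps(2))
  qed simp
  have pow: "?p ?k = ?p ?k ** X ** T" "?p ?k = T ** X ** ?p ?k" if "is_drazin_inverse X T" for T
  proof -
    have comm: "X ** T = T ** X" and pk: "?p ?k = ?p (Suc ?k) ** T"
      using that by (simp_all add: is_drazin_inverse_def)
    then show "?p ?k = ?p ?k ** X ** T"
      by (simp add: matrix_power_commute)
    have "?p j ** T = T ** ?p j" for j
      by (induction j) (simp_all, metis comm matrix_mul_assoc)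
    then show "?p ?k = T ** X ** ?p ?k"
      using pk by (metis matrix_mul_assoc matrix_power.simps(2))
  qed
  have "Y = Z ** X ** Y"
    by (metis assms right pow(2) matrix_mul_assoc)
  moreover have "Z = Z ** X ** Y"
    by (metis assms left pow(1) matrix_mul_assoc)
  ultimately show ?thesis
    by simp
qed

lemma drazin_is_drazin_inverse: "is_drazin_inverse X (drazin X)"
  unfolding drazin_def
  by (metis is_drazin_inverse_exists is_drazin_inverse_unique theI_unique)

lemma drazin_eqI: "is_drazin_inverse X Y \<Longrightarrow> drazin X = Y"
  using drazin_is_drazin_inverse is_drazin_inverse_unique by blast

lemma drazin_commute: "drazin X ** X = X ** drazin X"
  and drazin_absorb: "drazin X ** X ** drazin X = drazin X"
  using drazin_is_drazin_inverse[of X] by (simp_all add: is_drazin_inverse_def)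

text \<open>The index need not be computed: \<open>?Q\<close> has \<open>X\<close> as a left factor,
  so \<open>X ** Y\<close> fixes it, and \<open>X ** Y\<close> commutes with powers of
  \<open>X\<close>.\<close>

lemma is_drazin_inverse_group_inverse:
  assumes "is_group_inverse X Y"
  shows "is_drazin_inverse X Y"
proof -
  let ?Q = "matrix_power X (matrix_index X)"
  have XY: "X ** Y ** X = X" "Y ** X ** Y = Y" "X ** Y = Y ** X"
    using assms unfolding is_group_inverse_def by blast+
  obtain W where W: "?Q = X ** ?Q ** W"
    by (rule matrix_power_index_right)
  have Y: "matrix_power X j ** (X ** Y) = X ** Y ** matrix_power X j" for j
    by (induction j) (simp_all, metis XY matrix_mul_assoc)
  have "X ** Y ** ?Q = ?Q"
    using W XY by (metis matrix_mul_assoc)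
  then have "?Q = ?Q ** (X ** Y)"
    by (simp add: Y)
  then have "?Q = matrix_power X (matrix_index X + 1) ** Y"
    by (simp add: matrix_mul_assoc flip: matrix_power_commute)
  with XY show ?thesis
    by (simp add: is_drazin_inverse_def)
qed

lemma group_inverse_eqI: "is_group_inverse X Y \<Longrightarrow> group_inverse X = Y"
  unfolding group_inverse_def
  by (metis (no_types, lifting) is_drazin_inverse_group_inverse is_drazin_inverse_unique the_equality)

section \<open>Inverses in corner rings\<close>

lemma matrix_add_rdistrib: "(A + B) ** C = A ** C + B ** C"
  for A B :: "'a::ring_1^'n^'m"
  by (simp add: vec_eq_iff matrix_matrix_mult_def sum.distrib distrib_right)

lemma matrix_diff_ldistrib: "A ** (B - C) = A ** B - A ** C"
  for A :: "'a::ring_1^'n^'m"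
  by (simp add: vec_eq_iff matrix_matrix_mult_def sum_subtractf right_diff_distrib)

lemma matrix_diff_rdistrib: "(A - B) ** C = A ** C - B ** C"
  for A B :: "'a::ring_1^'n^'m"
  by (simp add: vec_eq_iff matrix_matrix_mult_def sum_subtractf left_diff_distrib)

lemma matrix_minus_left: "(- A) ** B = - (A ** B)"
  for A :: "'a::ring_1^'n^'m"
  by (simp add: vec_eq_iff matrix_matrix_mult_def sum_negf)

lemma matrix_minus_right: "A ** (- B) = - (A ** B)"
  for A :: "'a::ring_1^'n^'m"
  by (simp add: vec_eq_iff matrix_matrix_mult_def sum_negf)

lemmas matrix_distribs = matrix_add_ldistrib matrix_add_rdistrib matrix_diff_ldistrib
  matrix_diff_rdistrib matrix_minus_left matrix_minus_right

text \<open>If \<open>T\<close> inverts \<open>mat 1 + X ** Y\<close>, then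
  \<open>mat 1 - Y ** T ** X\<close> inverts the swapped matrix. A right inverse suffices for square
  matrices.\<close>

lemma invertible_one_plus_swap:
  fixes X Y :: "complex^'n^'n"
  assumes "invertible (mat 1 + X ** Y)"
  shows "invertible (mat 1 + Y ** X)"
proof -
  obtain T where "(mat 1 + X ** Y) ** T = mat 1"
    using assms invertible_right_inverse by blast
  then have T: "X ** (Y ** T) = mat 1 - T"
    by (simp add: matrix_distribs algebra_simps flip: matrix_mul_assoc)
  have "(mat 1 + Y ** X) ** (mat 1 - Y ** T ** X)
      = mat 1 + Y ** X - Y ** T ** X - Y ** (X ** (Y ** T)) ** X"
    by (simp add: matrix_distribs algebra_simps flip: matrix_mul_assoc)
  also have "\<dots> = mat 1"
    by (simp add: T matrix_distribs algebra_simps flip: matrix_mul_assoc)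
  finally show ?thesis
    using invertible_right_inverse by blast
qed

lemma invertible_mult_left_iff:
  fixes X Y :: "complex^'n^'n"
  assumes "invertible X"
  shows "invertible (X ** Y) \<longleftrightarrow> invertible Y"
proof
  assume "invertible (X ** Y)"
  then show "invertible Y"
    by (metis invertible_left_inverse matrix_mul_assoc)
qed (use assms invertible_mult in blast)

lemma matrix_inv_mult_cancel:
  fixes X Y :: "complex^'n^'n"
  assumes "invertible X"
  shows "matrix_inv X ** X = mat 1"
  using assms unfolding invertible_def matrix_inv_def by (rule someI2_ex) simp

text \<open>Here \<open>P\<close> is idempotent because \<open>P ** P = P ** X ** Y = X ** Y = P\<close>.\<close>

definition corner_inverse :: "complex^'n^'n \<Rightarrow> complex^'n^'n \<Rightarrow> complex^'n^'n \<Rightarrow> bool" where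
  "corner_inverse P X Y \<longleftrightarrow> X ** Y = P \<and> Y ** X = P \<and> P ** X = X \<and> P ** Y = Y"

lemma corner_inverseD:
  assumes "corner_inverse P X Y"
  shows "X ** Y = P" "Y ** X = P" "P ** X = X" "P ** Y = Y" "X ** P = X" "Y ** P = Y" "P ** P = P"
  using assms unfolding corner_inverse_def by (auto, (metis matrix_mul_assoc)+)

lemma corner_inverse_imp_is_group_inverse: "corner_inverse P X Y \<Longrightarrow> is_group_inverse X Y"
  by (simp add: corner_inverse_def is_group_inverse_def)

lemma corner_inverse_imp:
  assumes "corner_inverse P X Y"
  shows "has_group_inverse X" "group_inverse X = Y" "drazin X = Y" "core_proj X = P"
proof -
  note Y = corner_inverse_imp_is_group_inverse[OF assms]
  show "has_group_inverse X" "group_inverse X = Y"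
    using Y by (auto simp: has_group_inverse_def group_inverse_eqI)
  show "drazin X = Y"
    using Y by (intro drazin_eqI is_drazin_inverse_group_inverse)
  then show "core_proj X = P"
    by (simp add: core_proj_def corner_inverseD(1)[OF assms])
qed

lemma has_group_inverse_imp_corner_inverse:
  assumes "has_group_inverse X"
  shows "corner_inverse (core_proj X) X (group_inverse X)"
proof -
  obtain Y where Y: "is_group_inverse X Y"
    using assms by (auto simp: has_group_inverse_def)
  then have "group_inverse X = Y" "core_proj X = X ** Y"
    by (simp_all only: group_inverse_eqI core_proj_def drazin_eqI[OF is_drazin_inverse_group_inverse])
  then show ?thesis
    using Y unfolding is_group_inverse_def corner_inverse_def by metis
qed

text \<open>Turns statements (1), (2) and (3) into invertibility in a corner.\<close>

lemma has_group_inverse_core_proj_iff: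
  "has_group_inverse X \<and> core_proj X = P \<longleftrightarrow> (\<exists>Y. corner_inverse P X Y)"
  using has_group_inverse_imp_corner_inverse corner_inverse_imp by blast

text \<open>\<open>mat 1 - P + X\<close> is the direct sum of the identity on the kernel of
  \<open>P\<close> and of \<open>X\<close> on its range, so only the corner part matters.\<close>

lemma invertible_corner_iff:
  assumes "P ** P = P" "P ** X = X" "X ** P = X"
  shows "invertible (mat 1 - P + X) \<longleftrightarrow> (\<exists>Y. corner_inverse P X Y)"
proof
  let ?G = "mat 1 - P + X"
  assume "invertible ?G"
  then obtain T where T: "?G ** T = mat 1" "T ** ?G = mat 1"
    by (auto simp: invertible_def)
  have G: "P ** ?G = X" "?G ** P = X"
    using assms by (simp_all add: matrix_distribs)
  \<comment> \<open>\<open>?G\<close> commutes with \<open>P\<close>, hence so does its inverse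
    \<open>T\<close>; the corner inverse is then \<open>T ** P\<close>.\<close>
  have comm: "T ** P = P ** T"
    by (metis G T matrix_mul_assoc matrix_mul_lid matrix_mul_rid)
  have "X ** (T ** P) = P" "T ** P ** X = P" "P ** (T ** P) = T ** P"
    using comm G T assms by (metis matrix_mul_assoc matrix_mul_rid matrix_mul_lid)+
  then show "\<exists>Y. corner_inverse P X Y"
    using assms by (auto simp: corner_inverse_def)
next
  assume "\<exists>Y. corner_inverse P X Y"
  then obtain Y where "corner_inverse P X Y" ..
  then have "(mat 1 - P + X) ** (mat 1 - P + Y) = mat 1"
    by (simp add: matrix_distribs corner_inverseD)
  then show "invertible (mat 1 - P + X)"
    using invertible_right_inverse by blast
qed

lemma core_proj_idem: "core_proj X ** core_proj X = core_proj X"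
  unfolding core_proj_def by (metis drazin_absorb matrix_mul_assoc)

text \<open>Multiplying by the core projection removes the nilpotent part of \<open>X\<close>; what
  remains is inverted in the corner by the Drazin inverse.\<close>

lemma corner_inverse_drazin: "corner_inverse (core_proj X) (X ** core_proj X) (drazin X)"
  unfolding corner_inverse_def core_proj_def
  by (metis drazin_absorb drazin_commute matrix_mul_assoc)

text \<open>Covers (4), (5) with its alternative, and (6); applied to \<open>D\<close> and
  \<open>Z\<close> it gives (7), (8) and (9). The common meaning \<open>R\<close> is invertibility
  of \<open>s\<close> in the corner.\<close>

lemma corner_equivalences:
  fixes A S :: "complex^'n^'n"
  defines "s \<equiv> core_proj A ** S ** core_proj A"
  defines "R \<equiv> \<exists>Y. corner_inverse (core_proj A) s Y"
  shows "invertible (spectral_proj A + s) \<longleftrightarrow> R"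
    and "invertible (mat 1 + drazin A ** (s - A)) \<longleftrightarrow> R"
    and "invertible (mat 1 + drazin A ** (S - mat 1) ** A) \<longleftrightarrow> R"
    and "invertible (mat 1 + drazin A ** (s - A)) \<and>
       drazin s = matrix_inv (mat 1 + drazin A ** (s - A)) ** drazin A \<longleftrightarrow> R"
proof -
  let ?P = "core_proj A" and ?a = "A ** core_proj A" and ?a' = "drazin A"
  let ?W = "mat 1 + ?a' ** (s - A)"
  note P = core_proj_idem[of A] and a = corner_inverseD[OF corner_inverse_drazin[of A]]
  have s: "?P ** s = s" "s ** ?P = s"
    unfolding s_def by (metis P matrix_mul_assoc)+
  have aA: "?a' ** A = ?P" "A ** ?a' = ?P"
    by (simp_all add: core_proj_def drazin_commute)
  show 4: "invertible (spectral_proj A + s) \<longleftrightarrow> R"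
    unfolding spectral_proj_def R_def by (rule invertible_corner_iff[OF P s])
  have "(mat 1 - ?P + ?a') ** (mat 1 - ?P + ?a) = mat 1"
    by (simp add: matrix_distribs a P)
  then have inv: "invertible (mat 1 - ?P + ?a')"
    using invertible_right_inverse by blast
  have W: "?W = mat 1 - ?P + ?a' ** s"
    by (simp add: matrix_distribs aA)
  \<comment> \<open>\<open>?W\<close> differs from the matrix of (4) only by an invertible left
    factor.\<close>
  also have "\<dots> = (mat 1 - ?P + ?a') ** (spectral_proj A + s)"
    by (simp add: spectral_proj_def matrix_distribs a P s)
  finally show 5: "invertible ?W \<longleftrightarrow> R"
    using 4 invertible_mult_left_iff[OF inv] by simp
  \<comment> \<open>Two swaps: the first brings \<open>A\<close> to the front, where
    \<open>A ** ?a'\<close> is \<open>?P = ?P ** ?P\<close>; the second moves one \<open>?P\<close>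
    to the end.\<close>
  have "invertible (mat 1 + ?a' ** (S - mat 1) ** A)
      \<longleftrightarrow> invertible (mat 1 + A ** (?a' ** (S - mat 1)))"
    using invertible_one_plus_swap by blast
  also have "A ** (?a' ** (S - mat 1)) = ?P ** (?P ** (S - mat 1))"
    by (simp add: matrix_mul_assoc aA P)
  also have "invertible (mat 1 + \<dots>) \<longleftrightarrow> invertible (mat 1 + ?P ** (S - mat 1) ** ?P)"
    using invertible_one_plus_swap by blast
  also have "mat 1 + ?P ** (S - mat 1) ** ?P = spectral_proj A + s"
    by (simp add: s_def spectral_proj_def matrix_distribs P)
  finally show "invertible (mat 1 + ?a' ** (S - mat 1) ** A) \<longleftrightarrow> R"
    using 4 by simp
  show "invertible ?W \<and> drazin s = matrix_inv ?W ** ?a' \<longleftrightarrow> R"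
  proof
    assume R
    then obtain Y where Y: "corner_inverse ?P s Y"
      by (auto simp: R_def)
    have "?a' ** s ** Y = ?a'"
      by (metis Y a(6) corner_inverseD(1) matrix_mul_assoc)
    \<comment> \<open>The part \<open>mat 1 - ?P\<close> of \<open>?W\<close> kills
      \<open>Y\<close>, and \<open>?a' ** s\<close> sends it to \<open>?a'\<close>.\<close>
    then have "?W ** Y = ?a'"
      unfolding W by (simp add: matrix_distribs corner_inverseD[OF Y])
    moreover have "invertible ?W"
      using 5 \<open>R\<close> by simp
    ultimately have "Y = matrix_inv ?W ** ?a'"
      by (metis matrix_inv_mult_cancel matrix_mul_assoc matrix_mul_lid)
    with \<open>invertible ?W\<close> show "invertible ?W \<and> drazin s = matrix_inv ?W ** ?a'"
      using corner_inverse_imp(3)[OF Y] by simp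
  qed (use 5 in blast)
qed

section \<open>Schur complements\<close>

lemma block_matrix_mult:
  fixes P :: "complex^'n^'n" and T :: "complex^'m^'m"
  shows
  "block_matrix P Q R T ** block_matrix P' Q' R' T' =
    block_matrix (P ** P' + Q ** R') (P ** Q' + Q ** T') (R ** P' + T ** R') (R ** Q' + T ** T')"
proof -
  have "(\<Sum>k\<in>UNIV. f k) = (\<Sum>k\<in>UNIV. f (Inl k)) + (\<Sum>k\<in>UNIV. f (Inr k))"
    for f :: "'n + 'm \<Rightarrow> complex"
    using sum.Plus[of "UNIV :: 'n set" "UNIV :: 'm set" f] by simp
  then show ?thesis
    by (simp add: vec_eq_iff block_matrix_def matrix_matrix_mult_def split: sum.split)
qed

lemma block_matrix_eq_iff:
  "block_matrix P Q R T = block_matrix P' Q' R' T' \<longleftrightarrow> P = P' \<and> Q = Q' \<and> R = R' \<and> T = T'"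
  by (auto simp: vec_eq_iff block_matrix_def split_sum_all)

lemma block_matrix_cases:
  obtains P Q R T where "X = block_matrix P Q R T"
proof -
  have "X = block_matrix (\<chi> i j. X $ Inl i $ Inl j) (\<chi> i j. X $ Inl i $ Inr j)
      (\<chi> i j. X $ Inr i $ Inl j) (\<chi> i j. X $ Inr i $ Inr j)"
    by (simp add: vec_eq_iff block_matrix_def split: sum.split)
  then show thesis
    by (rule that)
qed

text \<open>Abstracts from Drazin inverses: \<open>a\<close> and \<open>d\<close> are invertible in
  the corners of \<open>P\<close> and \<open>Q\<close>, and \<open>b\<close>, \<open>c\<close> are
  off-diagonal blocks compressed to these corners.\<close>

locale block_corner =
  fixes P a a' :: "complex^'n^'n" and Q d d' :: "complex^'m^'m"
    and b :: "complex^'n^'m" and c :: "complex^'m^'n"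
  assumes corner_a: "corner_inverse P a a'" and corner_d: "corner_inverse Q d d'"
    and b: "Q ** b = b" "b ** P = b" and c: "P ** c = c" "c ** Q = c"
begin

definition "s = a - c ** d' ** b"
definition "z = d - b ** a' ** c"

lemmas a = corner_inverseD[OF corner_a] and d = corner_inverseD[OF corner_d]

lemma s_absorb: "P ** s = s" "s ** P = s"
  by (simp_all add: s_def matrix_distribs a matrix_mul_assoc c flip: matrix_mul_assoc[of _ b P] add: b)

lemma z_absorb: "Q ** z = z" "z ** Q = z"
  by (simp_all add: z_def matrix_distribs d matrix_mul_assoc b flip: matrix_mul_assoc[of _ c Q] add: c)

text \<open>The hypotheses are symmetric in the two blocks, so each result on \<open>s\<close>
  yields one on \<open>z\<close>.\<close>

lemma swap: "block_corner Q d d' P a a' c b"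
  using corner_a corner_d b c by unfold_locales

lemma swap_s: "block_corner.s d a' c b = z"
  by (simp add: block_corner.s_def[OF swap] z_def)

text \<open>The classical block inversion formula, with \<open>P\<close> and \<open>Q\<close> as the
  units of the two corners.\<close>

lemma schur_s:
  assumes "corner_inverse P s s'"
  shows "corner_inverse (block_matrix P 0 0 Q) (block_matrix a c b d)
    (block_matrix s' (- (s' ** c ** d')) (- (d' ** b ** s')) (d' ** b ** s' ** c ** d' + d'))"
proof -
  note s' = corner_inverseD[OF assms]
  have "a ** s' - c ** (d' ** (b ** s')) = P" "s' ** a - s' ** (c ** (d' ** b)) = P"
    using s'(1,2) by (simp_all add: s_def matrix_distribs matrix_mul_assoc)
  then have as: "a ** s' = P + c ** (d' ** (b ** s'))" "s' ** a = P + s' ** (c ** (d' ** b))"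
    by (simp_all add: algebra_simps)
  \<comment> \<open>The rewrite rules are repeated with a trailing factor \<open>x\<close>, since
    the final simplification associates products to the right.\<close>
  have as': "a ** (s' ** x) = P ** x + c ** (d' ** (b ** (s' ** x)))"
    for x :: "complex^'k^'n"
    using arg_cong[OF as(1), of "\<lambda>y. y ** x"] by (simp add: matrix_distribs matrix_mul_assoc)
  have dd: "d ** (d' ** x) = Q ** x" "d' ** (d ** x) = Q ** x" "Q ** (b ** y) = b ** y" "Q ** (d' ** x) = d' ** x"
     "P ** (c ** x) = c ** x" "P ** (s' ** y) = s' ** y" for x :: "complex^'k^'m" and y :: "complex^'k^'n"
    by (simp_all add: matrix_mul_assoc d b c s')
  show ?thesis
    unfolding corner_inverse_def
    by (simp add: block_matrix_mult block_matrix_eq_iff matrix_distribs a d b c s' as as' dd flip: matrix_mul_assoc)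
qed

lemma schur_z:
  assumes "corner_inverse Q z z'"
  shows "corner_inverse (block_matrix P 0 0 Q) (block_matrix a c b d)
    (block_matrix (a' ** c ** z' ** b ** a' + a') (- (a' ** c ** z')) (- (z' ** b ** a')) z')"
proof -
  have "corner_inverse (block_matrix Q 0 0 P) (block_matrix d b c a)
    (block_matrix z' (- (z' ** b ** a')) (- (a' ** c ** z')) (a' ** c ** z' ** b ** a' + a'))"
    using block_corner.schur_s[OF swap] assms by (simp add: swap_s)
  then show ?thesis
    by (simp add: corner_inverse_def block_matrix_mult block_matrix_eq_iff add.commute)
qed

text \<open>The upper left block \<open>x\<close> of the inverse inverts \<open>s\<close>: the
  off-diagonal equations determine \<open>w\<close> and \<open>y\<close> from \<open>x\<close>, and
  substituting them into the diagonal equations produces \<open>s\<close>.\<close>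

lemma schur_converse_s:
  assumes "corner_inverse (block_matrix P 0 0 Q) (block_matrix a c b d) X"
  shows "\<exists>x. corner_inverse P s x"
proof -
  obtain x y w v where X: "X = block_matrix x y w v"
    by (rule block_matrix_cases)
  have eqs: "a ** x + c ** w = P" "b ** x + d ** w = 0" "x ** a + y ** b = P" "x ** c + y ** d = 0"
    "P ** x = x" "Q ** w = w" "y ** Q = y"
    using corner_inverseD[OF assms] by (simp_all add: X block_matrix_mult block_matrix_eq_iff)
  have "d' ** (b ** x) + w = 0"
    using arg_cong[OF eqs(2), of "\<lambda>t. d' ** t"] by (simp add: matrix_distribs matrix_mul_assoc d eqs(6))
  then have "w = - (d' ** (b ** x))"
    by (simp add: eq_neg_iff_add_eq_0 add.commute)
  then have "s ** x = P"
    using eqs(1) by (simp add: s_def matrix_distribs flip: matrix_mul_assoc)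
  have "x ** c ** d' + y = 0"
    using arg_cong[OF eqs(4), of "\<lambda>t. t ** d'"]
    by (simp add: matrix_distribs d eqs(7) flip: matrix_mul_assoc)
  then have "y = - (x ** c ** d')"
    by (simp add: eq_neg_iff_add_eq_0 add.commute)
  then have "x ** s = P"
    using eqs(3) by (simp add: s_def matrix_distribs matrix_mul_assoc)
  with \<open>s ** x = P\<close> show ?thesis
    using eqs(5) s_absorb(1) by (auto simp: corner_inverse_def)
qed

lemma schur_converse_z:
  assumes "corner_inverse (block_matrix P 0 0 Q) (block_matrix a c b d) X"
  shows "\<exists>v. corner_inverse Q z v"
proof -
  obtain x y w v where "X = block_matrix x y w v"
    by (rule block_matrix_cases)
  then have "corner_inverse (block_matrix Q 0 0 P) (block_matrix d b c a) (block_matrix v w y x)"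
    using assms by (simp add: corner_inverse_def block_matrix_mult block_matrix_eq_iff add.commute)
  then show ?thesis
    using block_corner.schur_converse_s[OF swap] by (simp add: swap_s)
qed

text \<open>Leads from (10) back to corner invertibility, and from (11) through \<open>swap\<close>.
  A group inverse alone gives only an idempotent \<open>s ** s'\<close> below \<open>P\<close>; the
  two formulas force it to be \<open>P\<close>.\<close>

lemma group_inverse_formula_imp_corner:
  assumes "is_group_inverse s s'" "s' = a' ** c ** z' ** b ** a' + a'" "a' ** c ** z' = s' ** c ** d'"
  shows "corner_inverse P s s'"
proof -
  have s': "s ** s' ** s = s" "s' ** s ** s' = s'" "s ** s' = s' ** s"
    using assms(1) unfolding is_group_inverse_def by blast+
  have P: "P ** s' = s'" "s' ** P = s'"
    using s' s_absorb by (metis matrix_mul_assoc)+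
  let ?p = "P - s ** s'"
  have "?p ** s' = 0"
    using s' P by (simp add: matrix_distribs)
  \<comment> \<open>The second formula eliminates \<open>z'\<close> from the first, so every summand
    other than \<open>a'\<close> starts with \<open>s'\<close>.\<close>
  moreover have "s' = s' ** c ** d' ** b ** a' + a'"
    using assms(2,3) by simp
  ultimately have "?p ** a' = 0"
    by (metis add_0 matrix_add_ldistrib matrix_mul_assoc times0_left)
  then have "?p ** P = 0"
    by (metis a(2) matrix_mul_assoc times0_left)
  moreover have "?p ** P = ?p"
    by (simp add: matrix_diff_rdistrib a(7) P flip: matrix_mul_assoc)
  ultimately have "s ** s' = P"
    by simp
  then show ?thesis
    using s'(3) P s_absorb by (simp add: corner_inverse_def)
qed

end

section \<open>Equivalence of the twelve statements\<close>

theorem theorem2p2: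
  fixes A :: "complex^'n^'n" and B :: "complex^'n^'m"
    and C :: "complex^'m^'n" and D :: "complex^'m^'m"
    and S s :: "complex^'n^'n" and Z z :: "complex^'m^'m"
    and M E M_E :: "complex^('n + 'm)^('n + 'm)"
  assumes S: "S = A - C ** drazin D ** B"
    and s: "s = core_proj A ** S ** core_proj A"
    and Z: "Z = D - B ** drazin A ** C"
    and z: "z = core_proj D ** Z ** core_proj D"
    and M: "M = block_matrix A C B D"
    and E: "E = block_matrix (core_proj A) 0 0 (core_proj D)"
    and M_E: "M_E = E ** M ** E"
  shows "all_equivalent
   [ \<comment> \<open>(1)\<close>
     has_group_inverse M_E \<and> core_proj M_E = E,
     \<comment> \<open>(2)\<close>
     has_group_inverse s \<and> core_proj s = core_proj A,
     \<comment> \<open>(3)\<close>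
     has_group_inverse z \<and> core_proj z = core_proj D,
     \<comment> \<open>(4)\<close>
     invertible (spectral_proj A + s),
     \<comment> \<open>(5) and its alternative\<close>
     invertible (mat 1 + drazin A ** (s - A)),
     invertible (mat 1 + drazin A ** (S - mat 1) ** A),
     \<comment> \<open>(6)\<close>
     invertible (mat 1 + drazin A ** (s - A)) \<and>
       drazin s = matrix_inv (mat 1 + drazin A ** (s - A)) ** drazin A,
     \<comment> \<open>(7)\<close>
     invertible (spectral_proj D + z),
     \<comment> \<open>(8) and its alternative\<close>
     invertible (mat 1 + drazin D ** (z - D)),
     invertible (mat 1 + drazin D ** (Z - mat 1) ** D),
     \<comment> \<open>(9)\<close>
     invertible (mat 1 + drazin D ** (z - D)) \<and>
       drazin z = matrix_inv (mat 1 + drazin D ** (z - D)) ** drazin D,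
     \<comment> \<open>(10)\<close>
     has_group_inverse s \<and> has_group_inverse z \<and>
       group_inverse s = drazin A ** C ** group_inverse z ** B ** drazin A + drazin A \<and>
       drazin A ** C ** group_inverse z = group_inverse s ** C ** drazin D,
     \<comment> \<open>(11)\<close>
     has_group_inverse s \<and> has_group_inverse z \<and>
       group_inverse z = drazin D ** B ** group_inverse s ** C ** drazin D + drazin D \<and>
       drazin D ** B ** group_inverse s = group_inverse z ** B ** drazin A,
     \<comment> \<open>(12)\<close>
     has_group_inverse M_E \<and> has_group_inverse s \<and> has_group_inverse z \<and>
       group_inverse M_E =
         block_matrix
           (drazin A + drazin A ** C ** group_inverse z ** B ** drazin A)
           (- (drazin A ** C ** group_inverse z))
           (- (group_inverse z ** B ** drazin A))
           (group_inverse z) \<and>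
       group_inverse M_E =
         block_matrix
           (group_inverse s)
           (- (group_inverse s ** C ** drazin D))
           (- (drazin D ** B ** group_inverse s))
           (drazin D ** B ** group_inverse s ** C ** drazin D + drazin D) ]"
proof -
  let ?P = "core_proj A" and ?Q = "core_proj D" and ?a' = "drazin A" and ?d' = "drazin D"
  define a d b c where abcd: "a = A ** ?P" "d = D ** ?Q" "b = ?Q ** B ** ?P" "c = ?P ** C ** ?Q"
  have bPQ: "?Q ** b = b" "b ** ?P = b" and cPQ: "?P ** c = c" "c ** ?Q = c"
    unfolding abcd by (metis core_proj_idem matrix_mul_assoc)+
  have "corner_inverse ?P a ?a'" "corner_inverse ?Q d ?d'"
    unfolding abcd by (rule corner_inverse_drazin)+
  with bPQ cPQ interpret bc: block_corner ?P a ?a' ?Q d ?d' b c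
    by unfold_locales
  have corner_conj: "core_proj X ** X ** core_proj X = X ** core_proj X" for X :: "complex^'k^'k"
    using corner_inverseD(3)[OF corner_inverse_drazin] by (simp add: matrix_mul_assoc)
  \<comment> \<open>Between factors that absorb the projections, \<open>C\<close> and
    \<open>B\<close> may be replaced by their compressions \<open>c\<close> and
    \<open>b\<close>.\<close>
  have C: "X ** C ** Y = X ** c ** Y" if "X ** ?P = X" "?Q ** Y = Y" for X :: "complex^'n^'k" and Y :: "complex^'l^'m"
    unfolding abcd by (metis that matrix_mul_assoc)
  have B: "X ** B ** Y = X ** b ** Y" if "X ** ?Q = X" "?P ** Y = Y" for X :: "complex^'m^'k" and Y :: "complex^'l^'n"
    unfolding abcd by (metis that matrix_mul_assoc)
  have s_eq: "s = bc.s"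
  proof -
    have "?P ** C ** ?d' ** B ** ?P = c ** ?d' ** b"
      unfolding abcd by (metis bc.d(4,6) matrix_mul_assoc)
    then show ?thesis
      unfolding s S bc.s_def by (simp add: matrix_distribs matrix_mul_assoc corner_conj abcd(1))
  qed
  have z_eq: "z = bc.z"
  proof -
    have "?Q ** B ** ?a' ** C ** ?Q = b ** ?a' ** c"
      unfolding abcd by (metis bc.a(4,6) matrix_mul_assoc)
    then show ?thesis
      unfolding z Z bc.z_def by (simp add: matrix_distribs matrix_mul_assoc corner_conj abcd(2))
  qed
  have M_E_eq: "M_E = block_matrix a c b d"
    by (simp add: M_E M E block_matrix_mult corner_conj abcd)
  \<comment> \<open>The pivot: each listed statement is shown equivalent to
    \<open>R\<close>.\<close>
  define R where "R \<longleftrightarrow> (\<exists>Y. corner_inverse ?P s Y)"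
  have R_z: "R \<longleftrightarrow> (\<exists>Y. corner_inverse ?Q z Y)"
    and R_M: "R \<longleftrightarrow> (\<exists>Y. corner_inverse E M_E Y)"
    unfolding R_def s_eq z_eq M_E_eq E
    using bc.schur_s bc.schur_z bc.schur_converse_s bc.schur_converse_z by blast+
  note A_equivs = corner_equivalences[of A S, folded s, folded R_def]
    and D_equivs = corner_equivalences[of D Z, folded z, folded R_z]

  let ?s' = "group_inverse s" and ?z' = "group_inverse z"
  have group_s: "is_group_inverse s ?s'" if "has_group_inverse s"
    using has_group_inverse_imp_corner_inverse[OF that] by (rule corner_inverse_imp_is_group_inverse)
  have group_z: "is_group_inverse z ?z'" if "has_group_inverse z"
    using has_group_inverse_imp_corner_inverse[OF that] by (rule corner_inverse_imp_is_group_inverse)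
  have s'P: "?P ** ?s' = ?s'" "?s' ** ?P = ?s'" if "has_group_inverse s"
    using group_s[OF that] bc.s_absorb unfolding is_group_inverse_def s_eq
    by (metis matrix_mul_assoc)+
  have z'Q: "?Q ** ?z' = ?z'" "?z' ** ?Q = ?z'" if "has_group_inverse z"
    using group_z[OF that] bc.z_absorb unfolding is_group_inverse_def z_eq
    by (metis matrix_mul_assoc)+
  have to_corner:
    "?a' ** C ** ?z' = ?a' ** c ** ?z'" "?s' ** C ** ?d' = ?s' ** c ** ?d'"
    "?z' ** B ** ?a' = ?z' ** b ** ?a'" "?d' ** B ** ?s' = ?d' ** b ** ?s'"
    "?a' ** c ** ?z' ** B ** ?a' = ?a' ** c ** ?z' ** b ** ?a'"
    "?d' ** b ** ?s' ** C ** ?d' = ?d' ** b ** ?s' ** c ** ?d'"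
    if "has_group_inverse s" "has_group_inverse z"
    using s'P[OF that(1)] z'Q[OF that(2)] bc.a bc.d
    by (simp_all add: C B flip: matrix_mul_assoc)
       (simp_all add: C B matrix_mul_assoc)

  let ?F10 = "?s' = ?a' ** C ** ?z' ** B ** ?a' + ?a' \<and> ?a' ** C ** ?z' = ?s' ** C ** ?d'"
    and ?F11 = "?z' = ?d' ** B ** ?s' ** C ** ?d' + ?d' \<and> ?d' ** B ** ?s' = ?z' ** B ** ?a'"
    and ?X1 = "block_matrix (?a' + ?a' ** C ** ?z' ** B ** ?a') (- (?a' ** C ** ?z'))
      (- (?z' ** B ** ?a')) ?z'"
    and ?X2 = "block_matrix ?s' (- (?s' ** C ** ?d')) (- (?d' ** B ** ?s'))
      (?d' ** B ** ?s' ** C ** ?d' + ?d')"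
  have 12: "has_group_inverse M_E \<and> has_group_inverse s \<and> has_group_inverse z \<and>
    group_inverse M_E = ?X1 \<and> group_inverse M_E = ?X2" if R
  proof -
    obtain s' z' where s': "corner_inverse ?P s s'" and z': "corner_inverse ?Q z z'"
      using \<open>R\<close> R_def R_z by blast
    have gs: "has_group_inverse s" "?s' = s'" and gz: "has_group_inverse z" "?z' = z'"
      using corner_inverse_imp s' z' by blast+
    \<comment> \<open>Both Schur complement formulas give a corner inverse of \<open>M_E\<close>,
      hence its group inverse.\<close>
    have X1: "corner_inverse E M_E ?X1" and X2: "corner_inverse E M_E ?X2"
      using bc.schur_s[OF s'[unfolded s_eq]] bc.schur_z[OF z'[unfolded z_eq]]
      unfolding to_corner[OF gs(1) gz(1), unfolded gs(2) gz(2)] gs(2) gz(2) E M_E_eq by (simp_all only: add.commute)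
    show ?thesis
      by (intro conjI gs(1) gz(1) corner_inverse_imp(1,2)[OF X1] corner_inverse_imp(2)[OF X2])
  qed
  have eq1: "has_group_inverse M_E \<and> core_proj M_E = E \<longleftrightarrow> R"
    and eq2: "has_group_inverse s \<and> core_proj s = ?P \<longleftrightarrow> R"
    and eq3: "has_group_inverse z \<and> core_proj z = ?Q \<longleftrightarrow> R"
    unfolding has_group_inverse_core_proj_iff
    by (fact R_M[symmetric] R_def[symmetric] R_z[symmetric])+
  have 10: R if s: "has_group_inverse s" and z: "has_group_inverse z" and F: ?F10
  proof -
    note F' = F[unfolded to_corner[OF s z]]
    show ?thesis
      unfolding R_def
      using bc.group_inverse_formula_imp_corner[folded s_eq, OF group_s[OF s]
          F'[THEN conjunct1] F'[THEN conjunct2]] ..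
  qed
  have 11: R if s: "has_group_inverse s" and z: "has_group_inverse z" and F: ?F11
  proof -
    note F' = F[unfolded to_corner[OF s z]]
    show ?thesis
      unfolding R_z
      using block_corner.group_inverse_formula_imp_corner[OF bc.swap, unfolded bc.swap_s,
          folded z_eq, OF group_z[OF z] F'[THEN conjunct1] F'[THEN conjunct2]] ..
  qed
  \<comment> \<open>Comparing the four blocks of the two forms in (12) gives exactly the formulas of
    (10) and (11). So (12) supplies them when \<open>R\<close> holds, and (12) itself returns to
    \<open>R\<close> through (10) or (11).\<close>
  have formulas: "?F10 \<and> ?F11" if "?X1 = ?X2"
    using that unfolding block_matrix_eq_iff neg_equal_iff_equal by (metis add.commute)
  have eq10: "has_group_inverse s \<and> has_group_inverse z \<and> ?F10 \<longleftrightarrow> R"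
    and eq11: "has_group_inverse s \<and> has_group_inverse z \<and> ?F11 \<longleftrightarrow> R"
    and eq12: "has_group_inverse M_E \<and> has_group_inverse s \<and> has_group_inverse z \<and>
      group_inverse M_E = ?X1 \<and> group_inverse M_E = ?X2 \<longleftrightarrow> R"
    using 10 11 12 formulas by metis+

  have all_equivalentI: "all_equivalent ps" if "\<forall>p\<in>set ps. p \<longleftrightarrow> R" for ps
    using that by (auto simp: all_equivalent_def)
  show ?thesis
    by (rule all_equivalentI, unfold list.set ball_simps, intro conjI TrueI)
       (rule eq1 eq2 eq3 A_equivs D_equivs eq10 eq11 eq12)+
qed

end
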